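(* Let $p$ be a prime, $n$ a positive integer, and $F=GF(p^n)$ the field with $p^n$ elements. Let $$A(n,p)=\left\{V(a,b,c)=\begin{bmatrix}1&0&0\\ a&1&0\\ b&c&1\end{bmatrix} : a,b,c\in F\right\},$$ a group under matrix multiplication, which is given by $V(a,b,c)V(a',b',c')=V(a+a',\,b+b'+ca',\,c+c')$. Then the spectrum of its commuting graph is $$\operatorname{Spec}(\Gamma_{A(n,p)})=\left\{(-1)^{p^{3n}-2p^n-1},\ (p^{2n}-p^n-1)^{p^n+1}\right\}.$$
   Context: For a finite non-abelian group $G$ with centre $Z(G)$, the commuting graph $\Gamma_G$ is the simple undirected graph with vertex set $G\setminus Z(G)$ in which two distinct vertices $x,y$ are adjacent if and only if $xy=yx$. The spectrum $\operatorname{Spec}$ of a graph is the multiset of eigenvalues of its adjacency matrix, written $\{\lambda_1^{k_1},\dots,\lambda_r^{k_r}\}$, where $\lambda^{k}$ denotes that $\lambda$ is listed $k$ times. *)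

theory Defs
  imports
    "HOL-Library.Cardinality"
    "HOL-Algebra.Group"
    "Graph_Theory.Pair_Digraph"
    "Jordan_Normal_Form.Char_Poly"
begin

definition group_center :: "('g, 'm) monoid_scheme \<Rightarrow> 'g set" where
  "group_center G = {z \<in> carrier G. \<forall>x \<in> carrier G. z \<otimes>\<^bsub>G\<^esub> x = x \<otimes>\<^bsub>G\<^esub> z}"

text \<open>
  An undirected edge is represented by its two orientations, as in the locale \<^locale>\<open>pair_graph\<close>
  of finite simple undirected graphs.
\<close>

definition commuting_graph :: "('g, 'm) monoid_scheme \<Rightarrow> 'g pair_pre_digraph" where
  "commuting_graph G =
     \<lparr> pverts = carrier G - group_center G,
       parcs = {(x, y). x \<in> carrier G - group_center G \<and> y \<in> carrier G - group_center G \<and>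
                        x \<noteq> y \<and> x \<otimes>\<^bsub>G\<^esub> y = y \<otimes>\<^bsub>G\<^esub> x} \<rparr>"

lemma pair_graph_commuting_graph:
  assumes "finite (carrier G)"
  shows "pair_graph (commuting_graph G)"
proof -
  have "parcs (commuting_graph G) \<subseteq> carrier G \<times> carrier G"
    by (auto simp: commuting_graph_def)
  then have "finite (parcs (commuting_graph G))"
    using assms finite_subset by blast
  moreover have "symmetric (with_proj (commuting_graph G))"
    by (auto simp: commuting_graph_def symmetric_def sym_def)
  moreover have "finite (pverts (commuting_graph G))"
    using assms by (simp add: commuting_graph_def)
  ultimately show ?thesis
    by (unfold_locales; (assumption | force simp: commuting_graph_def))
qed

definition adjacency_matrix :: "'v pair_pre_digraph \<Rightarrow> 'v list \<Rightarrow> complex mat" where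
  "adjacency_matrix \<Gamma> vs =
     mat (length vs) (length vs) (\<lambda>(i, j). if (vs ! i, vs ! j) \<in> parcs \<Gamma> then 1 else 0)"

text \<open>
  The eigenvalues are taken over the complex numbers, so that the spectrum has exactly as many
  members as the graph has vertices; \<^const>\<open>proots\<close> counts each of them with its multiplicity in
  the characteristic polynomial. The choice of the enumeration of the vertices is irrelevant, see
  \<open>graph_spectrum_eqI\<close> below. The definition is meaningful for finite graphs only.
\<close>

definition graph_spectrum :: "'v pair_pre_digraph \<Rightarrow> complex multiset" where
  "graph_spectrum \<Gamma> =
     proots (char_poly (adjacency_matrix \<Gamma> (SOME vs. distinct vs \<and> set vs = pverts \<Gamma>)))"

lemma char_poly_adjacency_matrix_permute:
  assumes "distinct vs" "distinct ws" "set vs = set ws"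
  shows "char_poly (adjacency_matrix \<Gamma> vs) = char_poly (adjacency_matrix \<Gamma> ws)"
proof -
  let ?n = "length ws"
  have "mset vs = mset ws"
    using assms set_eq_iff_mset_eq_distinct by blast
  then obtain p where p: "p permutes {..<?n}" and vs: "permute_list p ws = vs"
    using mset_eq_permutation by blast
  have len: "length vs = ?n"
    using vs by auto
  have nth: "vs ! i = ws ! p i" if "i < ?n" for i
    using vs permute_list_nth[OF p that] by simp
  have p0: "p permutes {0..<?n}"
    using p by (simp add: atLeast0LessThan)
  have plt: "p i < ?n" if "i < ?n" for i
    using permutes_in_image[OF p, of i] that by simp
  have pinj: "p i = p j \<longleftrightarrow> i = j" for i j
    using permutes_inj[OF p] by (auto dest: injD)
  define A where "A = char_poly_matrix (adjacency_matrix \<Gamma> ws)"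
  define B where "B = mat ?n ?n (\<lambda>(i, j). A $$ (p i, j))"
  have A: "A \<in> carrier_mat ?n ?n" and B: "B \<in> carrier_mat ?n ?n"
    by (auto simp: A_def B_def char_poly_matrix_def adjacency_matrix_def)
  have "char_poly_matrix (adjacency_matrix \<Gamma> vs) =
        transpose_mat (mat ?n ?n (\<lambda>(i, j). transpose_mat B $$ (p i, j)))"
    by (rule eq_matI)
      (auto simp: A_def B_def char_poly_matrix_def adjacency_matrix_def len nth plt pinj)
  also have "det \<dots> = signof p * (signof p * det A)"
    using det_permute_rows[OF A p0] det_permute_rows[OF transpose_carrier_mat[THEN iffD2, OF B] p0]
      det_transpose[OF B]
    by (subst det_transpose[of _ ?n]) (auto simp: B_def)
  also have "\<dots> = det A"
    by (simp add: sign_def)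
  finally show ?thesis
    by (simp add: char_poly_def A_def)
qed

lemma graph_spectrum_eqI:
  assumes "distinct vs" "set vs = pverts \<Gamma>"
  shows "graph_spectrum \<Gamma> = proots (char_poly (adjacency_matrix \<Gamma> vs))"
proof -
  let ?ws = "SOME vs. distinct vs \<and> set vs = pverts \<Gamma>"
  have "distinct ?ws \<and> set ?ws = pverts \<Gamma>"
    by (rule someI[of _ vs]) (use assms in simp)
  then show ?thesis
    unfolding graph_spectrum_def
    using assms char_poly_adjacency_matrix_permute[of ?ws vs \<Gamma>] by simp
qed

definition V :: "'a :: field \<Rightarrow> 'a \<Rightarrow> 'a \<Rightarrow> 'a mat" where
  "V a b c = mat_of_rows_list 3
     [[1, 0, 0],
      [a, 1, 0],
      [b, c, 1]]"

text \<open>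
  The parameters of \<open>A(n,p)\<close> enter through the field: \<open>'a\<close> is to be a field with \<open>p ^ n\<close> elements.
\<close>

definition A_group :: "'a :: field mat monoid" where
  "A_group = \<lparr> carrier = {V a b c | a b c. True}, mult = (*), one = 1\<^sub>m 3 \<rparr>"

lemma V_mult: "V a b c * V a' b' c' = V (a + a') (b + b' + c * a') (c + c')"
  by (rule eq_matI)
    (auto simp: V_def mat_of_rows_list_def scalar_prod_def numeral_3_eq_3 less_Suc_eq)

lemma V_0: "V 0 0 0 = 1\<^sub>m 3"
  by (rule eq_matI) (auto simp: V_def mat_of_rows_list_def numeral_3_eq_3 less_Suc_eq)

lemma V_eq_iff: "V a b c = V a' b' c' \<longleftrightarrow> a = a' \<and> b = b' \<and> c = c'"
proof
  assume eq: "V a b c = V a' b' c'"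
  have "V a b c $$ (1, 0) = V a' b' c' $$ (1, 0)" "V a b c $$ (2, 0) = V a' b' c' $$ (2, 0)"
    "V a b c $$ (2, 1) = V a' b' c' $$ (2, 1)"
    by (simp_all add: eq)
  then show "a = a' \<and> b = b' \<and> c = c'"
    by (simp add: V_def mat_of_rows_list_def numeral_2_eq_2)
qed simp

lemma group_A_group: "group (A_group :: 'a :: field mat monoid)"
proof (rule groupI)
  fix x :: "'a mat"
  assume "x \<in> carrier A_group"
  then obtain a b c where x: "x = V a b c"
    by (auto simp: A_group_def)
  have "V (- a) (c * a - b) (- c) * x = V 0 0 0"
    by (simp add: x V_mult)
  then show "\<exists>y \<in> carrier A_group. y \<otimes>\<^bsub>A_group\<^esub> x = \<one>\<^bsub>A_group\<^esub>"
    by (auto simp: A_group_def V_0)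
qed (auto simp: A_group_def V_mult V_0[symmetric] V_eq_iff algebra_simps)

lemma card_A_group: "card (carrier (A_group :: 'a :: {field, finite} mat monoid)) = CARD('a) ^ 3"
proof -
  have "carrier (A_group :: 'a mat monoid) = (\<lambda>(a, b, c). V a b c) ` UNIV"
    by (simp add: A_group_def set_eq_iff image_iff)
  moreover have "inj (\<lambda>(a, b, c). V a b c :: 'a mat)"
    by (auto simp: inj_def V_eq_iff)
  ultimately show ?thesis
    by (simp add: card_image power3_eq_cube)
qed

lemma A_group_nonabelian: "\<not> comm_group (A_group :: 'a :: field mat monoid)"
proof
  assume "comm_group (A_group :: 'a mat monoid)"
  then interpret comm_group "A_group :: 'a mat monoid" .
  have "V 1 0 0 * V 0 0 1 = V 0 0 1 * (V 1 0 0 :: 'a mat)"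
    using m_comm[of "V 1 0 0" "V 0 0 1"] by (auto simp: A_group_def)
  then show False
    by (simp add: V_mult V_eq_iff)
qed

end

theory Submission
  imports Defs
begin

text \<open>
  Two elements \<open>V a b c\<close> and \<open>V a' b' c'\<close> commute iff \<open>c a' = c' a\<close>. So the centre is \<open>a = c = 0\<close>, and
  off the centre commuting is an equivalence relation, the class being the point of the projective
  line spanned by \<open>(a, c)\<close>. With \<open>q = p ^ n\<close> the graph is a disjoint union of \<open>q + 1\<close> complete graphs
  on \<open>(q - 1) q\<close> vertices.
\<close>

section \<open>Characteristic polynomial of a complete graph\<close>

lemma index_mult_mat_sum:
  assumes "A \<in> carrier_mat n m" "B \<in> carrier_mat m k" "i < n" "j < k"
  shows "(A * B) $$ (i, j) = (\<Sum>l<m. A $$ (i, l) * B $$ (l, j))"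
  using assms by (auto simp: scalar_prod_def atLeast0LessThan intro!: sum.cong)

text \<open>
  Conjugating by the unipotent matrix whose first column is constantly \<open>1\<close> takes the all-ones
  vector to the first basis vector, which makes the adjacency matrix upper triangular.
\<close>

lemma char_poly_complete_graph:
  assumes "n > 0"
  shows "char_poly (mat n n (\<lambda>(i, j). if i = j then 0 else 1) :: 'a :: field mat) =
           [:1 - of_nat n, 1:] * [:1, 1:] ^ (n - 1)"
proof -
  define K :: "'a mat" where "K = mat n n (\<lambda>(i, j). if i = j then 0 else 1)"
  define P :: "'a mat" where "P = mat n n (\<lambda>(i, j). if i = j \<or> j = 0 then 1 else 0)"
  \<comment> \<open>\<open>Q\<close> is the inverse of \<open>P\<close>: multiplying by it on the
    left subtracts row 0 from every other row.\<close>
  define Q :: "'a mat" where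
    "Q = mat n n (\<lambda>(i, j). (if i = j then 1 else 0) - (if j = 0 \<and> i \<noteq> 0 then 1 else 0))"
  define T :: "'a mat" where
    "T = mat n n (\<lambda>(i, j). if i = j then (if i = 0 then of_nat n - 1 else - 1)
                           else if i = 0 then 1 else 0)"
  have carrier: "K \<in> carrier_mat n n" "P \<in> carrier_mat n n" "Q \<in> carrier_mat n n"
    "T \<in> carrier_mat n n"
    by (auto simp: K_def P_def Q_def T_def)
  have Q_mult: "(Q * X) $$ (i, j) = X $$ (i, j) - (if i = 0 then 0 else X $$ (0, j))"
    if "X \<in> carrier_mat n n" "i < n" "j < n" for X i j
  proof -
    have "(Q * X) $$ (i, j) = (\<Sum>l<n. ((if i = l then 1 else 0) -
                                       (if l = 0 \<and> i \<noteq> 0 then 1 else 0)) * X $$ (l, j))"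
      using that carrier by (subst index_mult_mat_sum) (auto simp: Q_def intro!: sum.cong)
    also have "\<dots> = (\<Sum>l<n. (if i = l then X $$ (l, j) else 0)) -
                     (\<Sum>l<n. (if l = 0 then (if i = 0 then 0 else X $$ (l, j)) else 0))"
      by (subst sum_subtractf[symmetric]) (auto intro!: sum.cong)
    finally show ?thesis
      using that by simp
  qed
  have QP: "Q * P = 1\<^sub>m n"
    using carrier
    by (intro eq_matI) (auto simp: Q_mult simp del: index_mult_mat(1), auto simp: P_def)
  then have PQ: "P * Q = 1\<^sub>m n"
    using mat_mult_left_right_inverse[OF carrier(3,2)] by simp
  \<comment> \<open>Column 0 of \<open>K * P\<close> collects the row sums of \<open>K\<close>, all
    equal to n - 1; the other columns of \<open>P\<close> are unit vectors and leave those of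
    \<open>K\<close> unchanged.\<close>
  have KP: "(K * P) $$ (i, j) = (if j = 0 then of_nat n - 1 else K $$ (i, j))"
    if "i < n" "j < n" for i j
  proof -
    have "(K * P) $$ (i, j) = (\<Sum>l<n. K $$ (i, l) * (if l = j \<or> j = 0 then 1 else 0))"
      using that carrier by (subst index_mult_mat_sum) (auto simp: P_def intro!: sum.cong)
    also have "\<dots> = (if j = 0 then \<Sum>l<n. K $$ (i, l) else K $$ (i, j))"
      using that by (auto simp: if_distrib cong: if_cong)
    also have "(\<Sum>l<n. K $$ (i, l)) = (\<Sum>l\<in>{..<n} - {i}. 1)"
      using that by (intro sum.mono_neutral_cong_right) (auto simp: K_def)
    also have "\<dots> = of_nat n - 1"
      using that by simp
    finally show ?thesis .
  qed
  have "T = Q * (K * P)"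
  proof (rule eq_matI)
    fix i j
    assume "i < dim_row (Q * (K * P))" "j < dim_col (Q * (K * P))"
    then have "i < n" "j < n"
      using carrier by auto
    then have "(Q * (K * P)) $$ (i, j) =
               (if j = 0 then of_nat n - 1 else K $$ (i, j)) -
               (if i = 0 then 0 else if j = 0 then of_nat n - 1 else K $$ (0, j))"
      using carrier by (simp add: Q_mult KP del: index_mult_mat(1))
    then show "T $$ (i, j) = (Q * (K * P)) $$ (i, j)"
      using \<open>i < n\<close> \<open>j < n\<close> by (auto simp: T_def K_def)
  qed (use carrier in auto)
  then have "T = Q * K * P"
    using carrier assoc_mult_mat[of Q n n K n P n] by simp
  then have "similar_mat T K"
    using carrier PQ QP by (intro similar_matI[of _ _ Q P n]) blast+
  then have "char_poly K = char_poly T"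
    by (simp add: char_poly_similar)
  also have "\<dots> = (\<Prod>a\<leftarrow>diag_mat T. [:- a, 1:])"
    by (rule char_poly_upper_triangular) (auto simp: T_def)
  also have "\<dots> = (\<Prod>i<n. [:- (T $$ (i, i)), 1:])"
    using carrier
    by (simp add: diag_mat_def prod.distinct_set_conv_list[symmetric] atLeast0LessThan comp_def)
  also have "\<dots> = [:- (T $$ (0, 0)), 1:] * (\<Prod>i\<in>{..<n} - {0}. [:- (T $$ (i, i)), 1:])"
    using assms by (intro prod.remove) auto
  also have "(\<Prod>i\<in>{..<n} - {0}. [:- (T $$ (i, i)), 1:]) = (\<Prod>i\<in>{..<n} - {0}. [:1, 1:])"
    by (intro prod.cong) (auto simp: T_def)
  finally show ?thesis
    using assms by (simp add: K_def T_def)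
qed

section \<open>Spectra of disjoint unions of complete graphs\<close>

lemma char_poly_four_block_diag:
  fixes A B :: "'a :: idom mat"
  assumes A: "A \<in> carrier_mat n n" and B: "B \<in> carrier_mat m m"
  shows "char_poly (four_block_mat A (0\<^sub>m n m) (0\<^sub>m m n) B) = char_poly A * char_poly B"
proof -
  have "char_poly_matrix (four_block_mat A (0\<^sub>m n m) (0\<^sub>m m n) B) =
        four_block_mat (char_poly_matrix A) (0\<^sub>m n m) (0\<^sub>m m n) (char_poly_matrix B)"
    using A B by (intro eq_matI) (auto simp: char_poly_matrix_def)
  then show ?thesis
    using A B by (simp add: char_poly_def det_four_block_mat_upper_right_zero[of _ n _ m])
qed

lemma adjacency_matrix_append:
  assumes "\<And>x y. x \<in> set vs \<Longrightarrow> y \<in> set ws \<Longrightarrow> (x, y) \<notin> parcs \<Gamma> \<and> (y, x) \<notin> parcs \<Gamma>"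
  shows "adjacency_matrix \<Gamma> (vs @ ws) =
           four_block_mat (adjacency_matrix \<Gamma> vs) (0\<^sub>m (length vs) (length ws))
             (0\<^sub>m (length ws) (length vs)) (adjacency_matrix \<Gamma> ws)"
  using assms by (intro eq_matI) (auto simp: adjacency_matrix_def nth_append)

lemma char_poly_adjacency_matrix_clique:
  assumes "distinct vs" "vs \<noteq> []"
    and "\<And>x y. x \<in> set vs \<Longrightarrow> y \<in> set vs \<Longrightarrow> (x, y) \<in> parcs \<Gamma> \<longleftrightarrow> x \<noteq> y"
  shows "char_poly (adjacency_matrix \<Gamma> vs) =
           [:1 - of_nat (length vs), 1:] * [:1, 1:] ^ (length vs - 1)"
proof -
  have "adjacency_matrix \<Gamma> vs =
        mat (length vs) (length vs) (\<lambda>(i, j). if i = j then 0 else 1)"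
    using assms by (intro eq_matI) (auto simp: adjacency_matrix_def nth_eq_iff_index_eq)
  then show ?thesis
    using assms by (simp add: char_poly_complete_graph)
qed

text \<open>Listing the vertices clique by clique makes the adjacency matrix block diagonal, so each
  induction step contributes one factor. One such enumeration suffices, since
  \<open>graph_spectrum_eqI\<close> accepts any.\<close>

lemma char_poly_adjacency_matrix_disjoint_cliques:
  assumes "finite I"
    and "\<And>i. i \<in> I \<Longrightarrow> finite (B i) \<and> B i \<noteq> {}"
    and "disjoint_family_on B I"
    and "\<And>i j x y. i \<in> I \<Longrightarrow> j \<in> I \<Longrightarrow> x \<in> B i \<Longrightarrow> y \<in> B j \<Longrightarrow>
           (x, y) \<in> parcs \<Gamma> \<longleftrightarrow> i = j \<and> x \<noteq> y"
  shows "\<exists>vs. distinct vs \<and> set vs = (\<Union>i\<in>I. B i) \<and>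
           char_poly (adjacency_matrix \<Gamma> vs) =
             (\<Prod>i\<in>I. [:1 - of_nat (card (B i)), 1:] * [:1, 1:] ^ (card (B i) - 1))"
  using assms
proof (induction I rule: finite_induct)
  case empty
  have "char_poly (adjacency_matrix \<Gamma> []) = 1"
    by (simp add: char_poly_def char_poly_matrix_def adjacency_matrix_def det_dim_zero)
  then show ?case
    by (intro exI[of _ "[]"]) simp
next
  case (insert i I)
  have "disjoint_family_on B I"
    using insert.prems(2) by (auto simp: disjoint_family_on_def)
  from insert.IH[OF insert.prems(1) this insert.prems(3)]
  obtain ws where ws: "distinct ws" "set ws = (\<Union>i\<in>I. B i)"
    "char_poly (adjacency_matrix \<Gamma> ws) =
       (\<Prod>i\<in>I. [:1 - of_nat (card (B i)), 1:] * [:1, 1:] ^ (card (B i) - 1))"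
    by auto
  obtain vs where vs: "distinct vs" "set vs = B i"
    using insert.prems(1)[of i] finite_distinct_list[of "B i"] by auto
  \<comment> \<open>The new index \<open>i\<close> lies outside \<open>I\<close>, so no edge joins
    its clique to the earlier ones.\<close>
  have "(x, y) \<notin> parcs \<Gamma> \<and> (y, x) \<notin> parcs \<Gamma>" if "x \<in> set vs" "y \<in> set ws" for x y
    using that insert.hyps(2) insert.prems(3) by (auto simp: vs ws(2))
  then have "char_poly (adjacency_matrix \<Gamma> (vs @ ws)) =
             char_poly (adjacency_matrix \<Gamma> vs) * char_poly (adjacency_matrix \<Gamma> ws)"
    by (subst adjacency_matrix_append; (subst char_poly_four_block_diag)?)
      (auto simp: adjacency_matrix_def)
  moreover have "char_poly (adjacency_matrix \<Gamma> vs) =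
                 [:1 - of_nat (length vs), 1:] * [:1, 1:] ^ (length vs - 1)"
    using vs insert.prems(1)[of i] insert.prems(3)[of i i]
    by (intro char_poly_adjacency_matrix_clique) auto
  moreover have "length vs = card (B i)"
    using vs distinct_card by metis
  moreover have "distinct (vs @ ws)"
    using vs ws insert.prems(2) insert.hyps(2) by (fastforce simp: disjoint_family_on_def)
  ultimately show ?case
    using insert.hyps vs ws by (intro exI[of _ "vs @ ws"]) auto
qed

lemma sum_constant_mset: "(\<Sum>x\<in>A. M) = repeat_mset (card A) (M :: 'a multiset)"
  by (induction A rule: infinite_finite_induct) auto

lemma graph_spectrum_disjoint_cliques:
  assumes "finite I"
    and "\<And>i. i \<in> I \<Longrightarrow> finite (B i) \<and> B i \<noteq> {}"
    and "disjoint_family_on B I"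
    and "\<And>i j x y. i \<in> I \<Longrightarrow> j \<in> I \<Longrightarrow> x \<in> B i \<Longrightarrow> y \<in> B j \<Longrightarrow>
           (x, y) \<in> parcs \<Gamma> \<longleftrightarrow> i = j \<and> x \<noteq> y"
    and "pverts \<Gamma> = (\<Union>i\<in>I. B i)"
  shows "graph_spectrum \<Gamma> =
           (\<Sum>i\<in>I. replicate_mset (card (B i) - 1) (- 1) + {#of_nat (card (B i)) - 1#})"
proof -
  obtain vs where "distinct vs" "set vs = pverts \<Gamma>" and
    cp: "char_poly (adjacency_matrix \<Gamma> vs) =
           (\<Prod>i\<in>I. [:1 - of_nat (card (B i)), 1:] * [:1, 1:] ^ (card (B i) - 1))"
    using char_poly_adjacency_matrix_disjoint_cliques[OF assms(1-4)] assms(5) by auto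
  then have "graph_spectrum \<Gamma> = proots (char_poly (adjacency_matrix \<Gamma> vs))"
    by (intro graph_spectrum_eqI)
  \<comment> \<open>Roots of a product add up as multisets because no factor is the zero
    polynomial.\<close>
  also have "\<dots> = (\<Sum>i\<in>I. proots ([:1 - of_nat (card (B i)), 1:] * [:1, 1:] ^ (card (B i) - 1)))"
    unfolding cp by (rule proots_prod) (simp del: mult_pCons_left mult_pCons_right)
  also have "\<dots> = (\<Sum>i\<in>I. replicate_mset (card (B i) - 1) (- 1) + {#of_nat (card (B i)) - 1#})"
    by (intro sum.cong refl, subst proots_mult)
      (simp_all add: proots_power)
  finally show ?thesis .
qed

section \<open>Commutation and centralizers in \<open>A_group\<close>\<close>

lemma V_commute_iff: "V a b c * V a' b' c' = V a' b' c' * V a b c \<longleftrightarrow> c * a' = c' * a"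
  by (auto simp: V_mult V_eq_iff algebra_simps)

lemma group_center_A_group: "group_center (A_group :: 'a :: field mat monoid) = {V 0 b 0 | b. True}"
proof -
  have V_center: "V a b c \<in> group_center A_group \<longleftrightarrow> a = 0 \<and> c = 0" for a b c :: 'a
  proof
    assume "V a b c \<in> group_center A_group"
    then have *: "V a b c * V a' b' c' = V a' b' c' * V a b c" for a' b' c'
      by (auto simp: group_center_def A_group_def)
    \<comment> \<open>Commuting with \<open>V 1 0 0\<close> forces c = 0, and commuting with
      \<open>V 0 0 1\<close> forces a = 0.\<close>
    show "a = 0 \<and> c = 0"
      using *[of 1 0 0] *[of 0 0 1] by (simp add: V_commute_iff)
  qed (auto simp: group_center_def A_group_def V_commute_iff)
  show ?thesis
  proof (intro equalityI subsetI)
    fix x :: "'a mat"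
    assume x: "x \<in> group_center A_group"
    then obtain a b c where "x = V a b c"
      by (auto simp: group_center_def A_group_def)
    with x show "x \<in> {V 0 b 0 | b. True}"
      by (auto simp: V_center)
  qed (auto simp: V_center)
qed

text \<open>
  Representatives of the points of the projective line.
\<close>

definition directions :: "('a :: field \<times> 'a) set" where
  "directions = insert (0, 1) (range (Pair 1))"

text \<open>For \<open>d\<close> in \<open>directions\<close> this is the centralizer of any of its
  own elements, with the centre removed: (a, c) runs over the nonzero multiples of \<open>d\<close>,
  while b is free.\<close>

definition clique :: "'a :: field \<times> 'a \<Rightarrow> 'a mat set" where
  "clique d = (\<lambda>(t, b). V (t * fst d) b (t * snd d)) ` ((UNIV - {0}) \<times> UNIV)"

lemma card_directions: "card (directions :: ('a :: {field, finite} \<times> 'a) set) = CARD('a) + 1"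
  by (auto simp: directions_def card_insert_if card_image inj_on_def)

lemma card_clique:
  fixes d :: "'a :: {field, finite} \<times> 'a"
  assumes "d \<in> directions"
  shows "card (clique d) = (CARD('a) - 1) * CARD('a)"
proof -
  \<comment> \<open>Every direction has a coordinate equal to 1, from which t can be read
    off.\<close>
  have "inj_on (\<lambda>(t, b). V (t * fst d) b (t * snd d)) ((UNIV - {0}) \<times> UNIV)"
    using assms by (auto simp: inj_on_def directions_def V_eq_iff)
  then show ?thesis
    by (simp add: clique_def card_image card_cartesian_product card_Diff_singleton)
qed

text \<open>The equation is the vanishing of a 2 x 2 determinant, so \<open>d\<close> and
  \<open>d'\<close> are proportional; the normalization of the representatives then makes them
  equal.\<close>

lemma directions_eqI:
  assumes "d \<in> directions" "d' \<in> directions" "snd d * fst d' = snd d' * fst d"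
  shows "d = d'"
  using assms by (auto simp: directions_def)

lemma clique_commute_iff:
  assumes "d \<in> directions" "d' \<in> directions" "x \<in> clique d" "y \<in> clique d'"
  shows "x * y = y * x \<longleftrightarrow> d = d'"
proof -
  obtain t b where x: "t \<noteq> 0" "x = V (t * fst d) b (t * snd d)"
    using assms(3) by (auto simp: clique_def)
  obtain t' b' where y: "t' \<noteq> 0" "y = V (t' * fst d') b' (t' * snd d')"
    using assms(4) by (auto simp: clique_def)
  \<comment> \<open>The commutation condition is bilinear, so the nonzero scalars t and t' factor
    out and only the directions matter.\<close>
  have "x * y = y * x \<longleftrightarrow> (t * t') * (snd d * fst d') = (t * t') * (snd d' * fst d)"
    unfolding x(2) y(2) V_commute_iff by (simp add: mult_ac)
  also have "\<dots> \<longleftrightarrow> snd d * fst d' = snd d' * fst d"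
    using x y by simp
  finally show ?thesis
    using directions_eqI[OF assms(1,2)] by auto
qed

lemma Union_clique:
  "(\<Union>d\<in>directions. clique d) = carrier A_group - group_center (A_group :: 'a :: field mat monoid)"
proof (intro equalityI subsetI)
  fix x :: "'a mat"
  assume x: "x \<in> (\<Union>d\<in>directions. clique d)"
  then have "x \<notin> group_center A_group"
    by (auto simp: directions_def clique_def group_center_A_group V_eq_iff)
  moreover from x have "x \<in> carrier A_group"
    by (auto simp: clique_def A_group_def)
  ultimately show "x \<in> carrier A_group - group_center A_group"
    by simp
next
  fix x :: "'a mat"
  assume "x \<in> carrier A_group - group_center A_group"
  then obtain a b c where x: "x = V a b c" and ac: "a \<noteq> 0 \<or> c \<noteq> 0"
    by (auto simp: group_center_A_group) (auto simp: A_group_def)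
  show "x \<in> (\<Union>d\<in>directions. clique d)"
  proof (cases "a = 0")
    case True
    then have "x \<in> clique (0, 1)"
      using ac x by (force simp: clique_def)
    then show ?thesis
      by (auto simp: directions_def)
  next
    case False
    \<comment> \<open>Here (a, c) = a (1, c / a), so the scalar is t = a.\<close>
    then have "x \<in> clique (1, c / a)"
      using x by (force simp: clique_def)
    then show ?thesis
      by (auto simp: directions_def)
  qed
qed

section \<open>Assembling the spectrum\<close>

theorem proposition2p9:
  fixes p n :: nat
  assumes "prime p" and "n > 0" and "CARD('a :: {field, finite}) = p ^ n"
  shows "graph_spectrum (commuting_graph (A_group :: 'a mat monoid)) =
           replicate_mset (p ^ (3 * n) - 2 * p ^ n - 1) (- 1) +
           replicate_mset (p ^ n + 1) (of_nat (p ^ (2 * n)) - of_nat (p ^ n) - 1)"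
proof -
  define q where "q = p ^ n"
  have q: "CARD('a) = q"
    using assms by (simp add: q_def)
  have "card {0, 1 :: 'a} \<le> CARD('a)"
    by (intro card_mono) auto
  then have "q \<ge> 2"
    using q by simp
  \<comment> \<open>Writing q as r + 2 lets the truncated subtractions in the multiplicity of -1 be
    evaluated exactly.\<close>
  then obtain r where r: "q = r + 2"
    using le_Suc_ex by (metis add.commute)
  have card_q: "card (clique d) = q * q - q" if "d \<in> directions" for d :: "'a \<times> 'a"
    using card_clique[OF that] by (simp add: q diff_mult_distrib)
  have "graph_spectrum (commuting_graph (A_group :: 'a mat monoid)) =
        (\<Sum>d\<in>(directions :: ('a \<times> 'a) set).
           replicate_mset (card (clique d) - 1) (- 1) + {#of_nat (card (clique d)) - 1#})"
  proof (rule graph_spectrum_disjoint_cliques)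
    \<comment> \<open>A common element of two cliques commutes with itself, so their directions
      agree.\<close>
    show "disjoint_family_on clique (directions :: ('a \<times> 'a) set)"
      unfolding disjoint_family_on_def using clique_commute_iff by blast
    show "pverts (commuting_graph (A_group :: 'a mat monoid)) = (\<Union>d\<in>directions. clique d)"
      by (simp add: commuting_graph_def Union_clique)
  next
    fix d d' :: "'a \<times> 'a" and x y
    assume *: "d \<in> directions" "d' \<in> directions" "x \<in> clique d" "y \<in> clique d'"
    then have "x \<in> carrier A_group - group_center A_group" "y \<in> carrier A_group - group_center A_group"
      unfolding Union_clique[symmetric] by auto
    then show "(x, y) \<in> parcs (commuting_graph A_group) \<longleftrightarrow> d = d' \<and> x \<noteq> y"
      using clique_commute_iff[OF *] by (auto simp: commuting_graph_def A_group_def)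
  next
    fix d :: "'a \<times> 'a"
    \<comment> \<open>The choice t = 1, b = 0 shows that the clique is nonempty.\<close>
    have "V (1 * fst d) 0 (1 * snd d) \<in> clique d"
      unfolding clique_def by (rule image_eqI[of _ _ "(1, 0)"]) auto
    then show "finite (clique d) \<and> clique d \<noteq> {}"
      by (auto simp: clique_def)
  qed simp
  also have "\<dots> = (\<Sum>d\<in>(directions :: ('a \<times> 'a) set).
                     replicate_mset (q * q - q - 1) (- 1) + {#of_nat (q * q - q) - 1#})"
    by (intro sum.cong) (simp_all add: card_q)
  also have "\<dots> = replicate_mset ((q + 1) * (q * q - q - 1)) (- 1) +
                   replicate_mset (q + 1) (of_nat (q * q - q) - 1)"
    unfolding sum_constant_mset
    by (rule multiset_eqI) (simp add: card_directions q)
  also have "(q + 1) * (q * q - q - 1) = q ^ 3 - 2 * q - 1"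
    by (simp add: r power3_eq_cube algebra_simps)
  \<comment> \<open>The clique size is a natural-number difference, but the stated eigenvalue
    subtracts in the complex numbers; q \<le> q * q reconciles them.\<close>
  also have "(of_nat (q * q - q) :: complex) = of_nat (q ^ 2) - of_nat q"
    by (simp add: of_nat_diff power2_eq_square)
  finally show ?thesis
    by (simp add: q_def power_mult[symmetric] mult.commute)
qed

end
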